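(* Let $\xi=(\xi_s)_{s\ge0}$ be an increasing Lévy process (a subordinator) with no drift, with jumps of infinite activity (infinite Lévy measure) and with all jumps of size at most $1$. Then there exists a non-negative continuous function $f:\mathbb{R}\to[0,\infty)$ such that $$\int_0^\infty f(y)\,dy=\infty\qquad\text{and}\qquad \mathbb{P}\left(\int_0^\infty f(\xi_s)\,ds<\infty\right)=1.$$
   Context: A Lévy process is an almost surely right-continuous (with left limits) real-valued process with stationary independent increments, started at $\xi_0=0$ under $\mathbb{P}$. Processes $\xi$ as in the claim have finite positive mean $\mathbb{E}[\xi_1]$ and do not possess a local time. *)

theory Defs
  imports "HOL-Probability.Probability"
begin

text \<open>Processes are indexed by type real; only times \<open>t \<ge> 0\<close> are meaningful, and nothing is
  assumed about \<open>\<xi> t\<close> for \<open>t < 0\<close>.  Path properties hold almost surely.\<close>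

locale levy_process = prob_space M for M :: "'a measure" +
  fixes \<xi> :: "real \<Rightarrow> 'a \<Rightarrow> real"
  assumes measurable_process: "\<And>t. 0 \<le> t \<Longrightarrow> \<xi> t \<in> borel_measurable M"
    and start_zero: "AE \<omega> in M. \<xi> 0 \<omega> = 0"
    and independent_increments:
      "\<And>(n::nat) (t :: nat \<Rightarrow> real). \<lbrakk>0 \<le> t 0; \<And>i. i < n \<Longrightarrow> t i \<le> t (Suc i)\<rbrakk> \<Longrightarrow>
         indep_vars (\<lambda>_. borel) (\<lambda>i \<omega>. \<xi> (t (Suc i)) \<omega> - \<xi> (t i) \<omega>) {..<n}"
    and stationary_increments:
      "\<And>s h. \<lbrakk>0 \<le> s; 0 \<le> h\<rbrakk> \<Longrightarrow>
         distr M borel (\<lambda>\<omega>. \<xi> (s + h) \<omega> - \<xi> s \<omega>) = distr M borel (\<lambda>\<omega>. \<xi> h \<omega> - \<xi> 0 \<omega>)"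
    and cadlag:
      "AE \<omega> in M. (\<forall>t\<ge>0. continuous (at_right t) (\<lambda>s. \<xi> s \<omega>)) \<and>
                  (\<forall>t>0. \<exists>l. ((\<lambda>s. \<xi> s \<omega>) \<longlongrightarrow> l) (at_left t))"

text \<open>Increasing is meant in the wide sense, as usual for subordinators.\<close>

locale subordinator = levy_process M \<xi> for M :: "'a measure" and \<xi> +
  assumes increasing: "AE \<omega> in M. mono_on {0..} (\<lambda>s. \<xi> s \<omega>)"

text \<open>The jump \<open>\<xi>\<^sub>t - \<xi>\<^sub>t\<^sub>-\<close>, for \<open>t > 0\<close>.\<close>

definition jump :: "(real \<Rightarrow> 'a \<Rightarrow> real) \<Rightarrow> real \<Rightarrow> 'a \<Rightarrow> real" where
  "jump \<xi> t \<omega> = \<xi> t \<omega> - Lim (at_left t) (\<lambda>s. \<xi> s \<omega>)"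

definition laplace_exponent :: "real \<Rightarrow> real measure \<Rightarrow> real \<Rightarrow> real" where
  "laplace_exponent d \<nu> q = d * q + (LINT x|\<nu>. 1 - exp (- q * x))"

text \<open>The drift and the Levy measure of a subordinator are the pair \<open>(d, \<nu>)\<close> of its
  Levy-Khintchine representation.  The measure \<open>\<nu>\<close> lives on \<open>(0, \<infinity>)\<close>; it is encoded as a
  Borel measure on the real line giving no mass to \<open>(-\<infinity>, 0]\<close>.\<close>

definition has_drift_and_levy_measure ::
    "'a measure \<Rightarrow> (real \<Rightarrow> 'a \<Rightarrow> real) \<Rightarrow> real \<Rightarrow> real measure \<Rightarrow> bool" where
  "has_drift_and_levy_measure M \<xi> d \<nu> \<longleftrightarrow>
     0 \<le> d \<and>
     sets \<nu> = sets borel \<and>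
     emeasure \<nu> {..0} = 0 \<and>
     (\<integral>\<^sup>+x. ennreal (min 1 x) \<partial>\<nu>) < \<infinity> \<and>
     (\<forall>t\<ge>0. \<forall>q\<ge>0. (LINT \<omega>|M. exp (- q * \<xi> t \<omega>)) = exp (- t * laplace_exponent d \<nu> q))"

end

theory Submission
  imports Defs
begin

text \<open>Let \<open>\<phi>\<close> be the Laplace exponent.  Without drift \<open>\<phi> q / q \<longlonglongrightarrow> 0\<close> as \<open>q \<longlonglongrightarrow> \<infinity>\<close>
  (\<open>laplace_exponent_sublinear\<close>), and this makes the range of \<open>\<xi>\<close> so thin that every unit interval
  contains a subinterval which the path hits with arbitrarily small probability
  (\<open>exists_rarely_visited_interval\<close>).  Choosing in each \<open>[n, n + 1]\<close> a subinterval hit with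
  probability at most \<open>2 ^ - n\<close> and placing there a continuous bump of integral at least \<open>1\<close> gives
  \<open>f\<close>: its integral is infinite, whereas by Borel-Cantelli almost every path meets only finitely many
  bumps.  As \<open>\<xi>\<close> is unbounded, \<open>f (\<xi> s)\<close> vanishes from some finite time on, and before that
  time it is bounded.

  The rarely hit intervals come from an averaging argument.  Cut a unit interval \<open>[y, y + 1]\<close> into
  \<open>N\<close> cells of length \<open>2 \<delta>\<close>, with \<open>\<delta> = 1 / (2 N)\<close>, and put \<open>\<tau> = 1 / (4 \<phi> (1 / \<delta>))\<close>.
  In a time span \<open>\<tau>\<close> the process advances by at most \<open>\<delta>\<close> with probability at least one half
  (\<open>prob_increment_le\<close>).  Hence, given that the left half of a cell is hit, with conditional
  probability at least one half the path stays in that cell for a time span \<open>\<tau>\<close>, and then the cell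
  contains \<open>\<xi> (i \<tau>)\<close> for some integer \<open>i\<close> (\<open>grid_hit_le\<close>, \<open>dyadic_visit_le\<close>).  The expected
  number of \<open>i\<close> with \<open>\<xi> (i \<tau>) \<le> y + 1\<close> is of order \<open>1 / \<tau>\<close>, that is, of order
  \<open>\<phi> (1 / \<delta>)\<close>; so the average over the cells of the probability that the left half is hit is of
  order \<open>\<delta> \<phi> (1 / \<delta>)\<close>, which tends to \<open>0\<close>.\<close>

section \<open>The Laplace exponent\<close>

lemma levy_measure_integrability:
  assumes "has_drift_and_levy_measure M \<xi> 0 \<nu>" "0 \<le> q"
  shows "integrable \<nu> (\<lambda>x. 1 - exp (- q * x))"
    and "integrable \<nu> (\<lambda>x. min 1 x)" and "AE x in \<nu>. 0 < x"
proof -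
  have sets: "sets \<nu> = sets borel" and null: "emeasure \<nu> {..0} = 0"
    and fin: "(\<integral>\<^sup>+x. ennreal (min 1 x) \<partial>\<nu>) < \<infinity>"
    using assms unfolding has_drift_and_levy_measure_def by auto
  note [measurable_cong] = sets
  have "{..0} \<in> null_sets \<nu>" using null sets by (auto simp: null_sets_def)
  from AE_not_in[OF this] show pos: "AE x in \<nu>. 0 < x"
    by eventually_elim auto
  show min: "integrable \<nu> (\<lambda>x. min 1 x)"
    using fin pos by (intro integrableI_nonneg) auto
  have "integrable \<nu> (\<lambda>x. (1 + q) * min 1 x)" using min by simp
  then show "integrable \<nu> (\<lambda>x. 1 - exp (- q * x))"
  proof (rule Bochner_Integration.integrable_bound)
    show "AE x in \<nu>. norm (1 - exp (- q * x)) \<le> norm ((1 + q) * min 1 x)"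
      using pos
    proof eventually_elim
      case (elim x)
      have "1 - exp (- q * x) \<le> q * x" using exp_ge_add_one_self[of "- q * x"] by simp
      moreover have "q * x \<le> (1 + q) * x" using elim by (simp add: algebra_simps)
      moreover have "1 - exp (- q * x) \<le> 1 + q" using assms(2) exp_gt_zero[of "- q * x"] by linarith
      ultimately have "1 - exp (- q * x) \<le> (1 + q) * min 1 x" by (auto simp: min_def)
      moreover have "1 - exp (- q * x) \<ge> 0" using elim assms(2) by simp
      ultimately show ?case by simp
    qed
  qed measurable
qed

lemma laplace_exponent_one_pos:
  assumes lk: "has_drift_and_levy_measure M \<xi> 0 \<nu>" and mass: "emeasure \<nu> {0<..} \<noteq> 0"
  shows "0 < laplace_exponent 0 \<nu> 1"
proof -
  note int = levy_measure_integrability[OF lk, of 1, simplified]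
  have nonneg: "AE x in \<nu>. 0 \<le> 1 - exp (- x)" using int(3) by eventually_elim simp
  have "(LINT x|\<nu>. 1 - exp (- x)) \<noteq> 0"
  proof
    assume "(LINT x|\<nu>. 1 - exp (- x)) = 0"
    then have "AE x in \<nu>. 1 - exp (- x) = 0"
      using integral_nonneg_eq_0_iff_AE[OF int(1) nonneg] by simp
    with int(3) have "AE x in \<nu>. False" by eventually_elim simp
    then have "emeasure \<nu> (space \<nu>) = 0" by (subst (asm) AE_iff_measurable[of "space \<nu>"]) auto
    moreover have "emeasure \<nu> {0<..} \<le> emeasure \<nu> (space \<nu>)" by (rule emeasure_space)
    ultimately show False using mass by simp
  qed
  moreover have "(LINT x|\<nu>. 1 - exp (- x)) \<ge> 0" using nonneg by (rule integral_nonneg_AE)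
  ultimately show ?thesis by (simp add: laplace_exponent_def)
qed

lemma laplace_exponent_mono:
  assumes lk: "has_drift_and_levy_measure M \<xi> 0 \<nu>" and "0 \<le> p" "p \<le> q"
  shows "laplace_exponent 0 \<nu> p \<le> laplace_exponent 0 \<nu> q"
  unfolding laplace_exponent_def
proof simp
  show "(LINT x|\<nu>. 1 - exp (- (p * x))) \<le> (LINT x|\<nu>. 1 - exp (- (q * x)))"
  proof (rule integral_mono_AE)
    show "AE x in \<nu>. 1 - exp (- (p * x)) \<le> 1 - exp (- (q * x))"
      using levy_measure_integrability(3)[OF lk order_refl]
      by eventually_elim (use assms in \<open>simp add: mult_right_mono\<close>)
  qed (use levy_measure_integrability(1)[OF lk, of p] levy_measure_integrability(1)[OF lk, of q] assms in auto)
qed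

text \<open>This sublinear growth is what the absence of drift means for \<open>\<phi>\<close>; it holds because the
  integrands \<open>(1 - exp (- q x)) / q\<close> tend to \<open>0\<close> and are dominated by \<open>min 1 x\<close> for
  \<open>q \<ge> 1\<close>.\<close>

lemma laplace_exponent_sublinear:
  assumes lk: "has_drift_and_levy_measure M \<xi> 0 \<nu>"
  shows "((\<lambda>q. laplace_exponent 0 \<nu> q / q) \<longlongrightarrow> 0) at_top"
proof -
  have sets: "sets \<nu> = sets borel" using lk unfolding has_drift_and_levy_measure_def by auto
  note [measurable_cong] = sets
  note int = levy_measure_integrability[OF lk]
  have "((\<lambda>q. LINT x|\<nu>. (1 - exp (- q * x)) / q) \<longlongrightarrow> (LINT x|\<nu>. 0)) at_top"
  proof (rule integral_dominated_convergence_at_top)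
    show "integrable \<nu> (\<lambda>x. min 1 x)" using int(2)[of 0] by simp
    show "\<forall>\<^sub>F q in at_top. AE x in \<nu>. norm ((1 - exp (- q * x)) / q) \<le> min 1 x"
      using eventually_ge_at_top[of 1]
    proof eventually_elim
      case (elim q)
      show ?case using int(3)[OF order_refl]
      proof eventually_elim
        case (elim x)
        have "1 - exp (- q * x) \<le> q * x" using exp_ge_add_one_self[of "- q * x"] by simp
        moreover have "1 - exp (- q * x) \<ge> 0" using elim \<open>1 \<le> q\<close> by simp
        moreover have "1 - exp (- q * x) \<le> q" using \<open>1 \<le> q\<close> exp_gt_zero[of "- q * x"] by linarith
        ultimately show ?case using \<open>1 \<le> q\<close> by (auto simp: field_simps)
      qed
    qed
    show "AE x in \<nu>. ((\<lambda>q. (1 - exp (- q * x)) / q) \<longlongrightarrow> 0) at_top"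
      using int(3)[OF order_refl]
    proof eventually_elim
      case (elim x)
      have "((\<lambda>q::real. 1 / q) \<longlongrightarrow> 0) at_top"
        by (intro tendsto_divide_0[OF tendsto_const] filterlim_at_top_imp_at_infinity filterlim_ident)
      then show ?case
      proof (rule tendsto_0_le[where K = 1])
        show "\<forall>\<^sub>F q in at_top. norm ((1 - exp (- q * x)) / q) \<le> norm (1 / q) * 1"
          using eventually_ge_at_top[of 1]
          by eventually_elim (use elim in \<open>auto simp: divide_simps\<close>)
      qed
    qed
  qed measurable
  then show ?thesis by (simp add: laplace_exponent_def)
qed

section \<open>Hitting probabilities of short intervals\<close>

text \<open>Only dyadic times are inspected, so that the event is measurable; for a right-continuous
  increasing path it is the event that the path ever enters \<open>[a, b)\<close>.\<close>

definition dyadic_visit :: "'a measure \<Rightarrow> (real \<Rightarrow> 'a \<Rightarrow> real) \<Rightarrow> real \<Rightarrow> real \<Rightarrow> 'a set" where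
  "dyadic_visit M \<xi> a b = {\<omega> \<in> space M. \<exists>(i::nat) (m::nat). \<xi> (real i / 2 ^ m) \<omega> \<in> {a..<b}}"

lemma (in levy_process) dyadic_visit_sets: "dyadic_visit M \<xi> a b \<in> sets M"
proof -
  have [measurable]: "\<xi> (real i / 2 ^ m) \<in> borel_measurable M" for i m :: nat
    by (rule measurable_process) simp
  show ?thesis unfolding dyadic_visit_def by measurable
qed

lemma (in subordinator) AE_nonneg: "AE \<omega> in M. \<forall>t\<ge>0. 0 \<le> \<xi> t \<omega>"
  using start_zero increasing
  by eventually_elim (metis atLeast_iff mono_onD order_refl)

lemma (in subordinator) integrable_exp:
  assumes "0 \<le> t" "0 \<le> q"
  shows "integrable M (\<lambda>\<omega>. exp (- q * \<xi> t \<omega>))"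
proof (rule integrable_const_bound[where B = 1])
  show "AE \<omega> in M. norm (exp (- q * \<xi> t \<omega>)) \<le> 1"
    using AE_nonneg by eventually_elim (use assms in simp)
qed (use measurable_process[OF assms(1)] in measurable)

text \<open>By stationarity it suffices to treat \<open>s = 0\<close>, where this is Markov's inequality for
  \<open>1 - exp (- \<xi> \<tau> / \<delta>)\<close>.\<close>

lemma (in subordinator) prob_increment_le:
  assumes lap: "\<And>t q. 0 \<le> t \<Longrightarrow> 0 \<le> q \<Longrightarrow> expectation (\<lambda>\<omega>. exp (- q * \<xi> t \<omega>)) = exp (- t * \<phi> q)"
    and "0 \<le> s" "0 \<le> \<tau>" "0 < \<delta>" and small: "\<tau> * \<phi> (1 / \<delta>) \<le> 1 / 4"
  shows "1 / 2 \<le> prob {\<omega> \<in> space M. \<xi> (s + \<tau>) \<omega> - \<xi> s \<omega> \<le> \<delta>}"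
proof -
  have m [measurable]: "\<xi> (s + \<tau>) \<in> borel_measurable M" "\<xi> s \<in> borel_measurable M"
      "\<xi> \<tau> \<in> borel_measurable M" "\<xi> 0 \<in> borel_measurable M"
    using assms by (auto intro: measurable_process)
  have "prob {\<omega> \<in> space M. \<xi> (s + \<tau>) \<omega> - \<xi> s \<omega> \<le> \<delta>}
      = measure (distr M borel (\<lambda>\<omega>. \<xi> (s + \<tau>) \<omega> - \<xi> s \<omega>)) {..\<delta>}"
    by (subst measure_distr) (auto intro!: arg_cong[where f = prob])
  also have "\<dots> = measure (distr M borel (\<lambda>\<omega>. \<xi> \<tau> \<omega> - \<xi> 0 \<omega>)) {..\<delta>}"
    by (simp add: stationary_increments assms)
  also have "\<dots> = prob {\<omega> \<in> space M. \<xi> \<tau> \<omega> - \<xi> 0 \<omega> \<le> \<delta>}"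
    by (subst measure_distr) (auto intro!: arg_cong[where f = prob])
  also have "\<dots> = prob {\<omega> \<in> space M. \<xi> \<tau> \<omega> \<le> \<delta>}"
    by (rule finite_measure_eq_AE) (use start_zero in auto)
  also have "\<dots> = 1 - prob {\<omega> \<in> space M. \<delta> < \<xi> \<tau> \<omega>}"
  proof -
    have "{\<omega> \<in> space M. \<xi> \<tau> \<omega> \<le> \<delta>} = space M - {\<omega> \<in> space M. \<delta> < \<xi> \<tau> \<omega>}" by auto
    then show ?thesis by (simp add: prob_compl)
  qed
  finally have eq: "prob {\<omega> \<in> space M. \<xi> (s + \<tau>) \<omega> - \<xi> s \<omega> \<le> \<delta>}
      = 1 - prob {\<omega> \<in> space M. \<delta> < \<xi> \<tau> \<omega>}" .
  let ?B = "{\<omega> \<in> space M. \<delta> < \<xi> \<tau> \<omega>}"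
  have "exp (- \<tau> * \<phi> (1 / \<delta>)) = expectation (\<lambda>\<omega>. exp (- (1 / \<delta>) * \<xi> \<tau> \<omega>))"
    using assms lap[of \<tau> "1 / \<delta>"] by simp
  also have "\<dots> \<le> expectation (\<lambda>\<omega>. 1 - indicator ?B \<omega> / 2)"
  proof (rule integral_mono_AE)
    show "integrable M (\<lambda>\<omega>. exp (- (1 / \<delta>) * \<xi> \<tau> \<omega>))" using assms by (intro integrable_exp) auto
    show "integrable M (\<lambda>\<omega>. 1 - indicator ?B \<omega> / 2 :: real)"
      by (rule integrable_const_bound[where B = 1]) (auto simp: indicator_def)
    have half: "exp (- 1) \<le> (1 / 2 :: real)"
      using exp_ge_add_one_self[of 1] by (simp add: exp_minus field_simps)
    show "AE \<omega> in M. exp (- (1 / \<delta>) * \<xi> \<tau> \<omega>) \<le> 1 - indicator ?B \<omega> / 2"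
      using AE_nonneg
    proof eventually_elim
      case (elim \<omega>)
      show ?case
      proof (cases "\<delta> < \<xi> \<tau> \<omega>")
        case True
        then have "- (1 / \<delta>) * \<xi> \<tau> \<omega> \<le> - 1" using \<open>0 < \<delta>\<close> by (simp add: field_simps)
        then have "exp (- (1 / \<delta>) * \<xi> \<tau> \<omega>) \<le> exp (- 1)" by (simp only: exp_le_cancel_iff)
        also note half
        finally show ?thesis using True elim \<open>0 < \<delta>\<close> \<open>0 \<le> \<tau>\<close> by (simp add: indicator_def)
      next
        case False
        then show ?thesis using elim assms by (simp add: indicator_def)
      qed
    qed
  qed
  also have "\<dots> = 1 - prob ?B / 2"
    by (subst Bochner_Integration.integral_diff) (auto simp: prob_space integrable_const_bound[where B = 1])
  finally have "exp (- \<tau> * \<phi> (1 / \<delta>)) \<le> 1 - prob ?B / 2" .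
  moreover have "1 - 1 / 4 \<le> exp (- \<tau> * \<phi> (1 / \<delta>))"
    using exp_ge_add_one_self[of "- \<tau> * \<phi> (1 / \<delta>)"] small by simp
  ultimately show ?thesis using eq by simp
qed

lemma (in levy_process) indep_past_increment:
  fixes t :: "nat \<Rightarrow> real"
  assumes t: "mono t" "t 0 = 0" and "0 \<le> \<tau>" and P: "Measurable.pred (PiM {..<k} (\<lambda>_. borel)) P"
    and B: "B \<in> sets borel"
  shows "prob {\<omega> \<in> space M. P (\<lambda>i\<in>{..<k}. \<xi> (t (Suc i)) \<omega> - \<xi> (t i) \<omega>) \<and> \<xi> (t k + \<tau>) \<omega> - \<xi> (t k) \<omega> \<in> B}
    = prob {\<omega> \<in> space M. P (\<lambda>i\<in>{..<k}. \<xi> (t (Suc i)) \<omega> - \<xi> (t i) \<omega>)}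
      * prob {\<omega> \<in> space M. \<xi> (t k + \<tau>) \<omega> - \<xi> (t k) \<omega> \<in> B}"
proof -
  define u where "u i = (if i \<le> k then t i else t k + \<tau>)" for i
  define X where "X i \<omega> = \<xi> (u (Suc i)) \<omega> - \<xi> (u i) \<omega>" for i \<omega>
  have "indep_vars (\<lambda>_. borel) X {..<Suc k}"
    unfolding X_def
    by (rule independent_increments)
      (use assms monoD[OF t(1)] in \<open>auto simp: u_def not_less_eq_eq le_Suc_eq\<close>)
  then have ind: "indep_var (PiM {..<k} (\<lambda>_. borel)) (\<lambda>\<omega>. \<lambda>i\<in>{..<k}. X i \<omega>)
      (PiM {k} (\<lambda>_. borel)) (\<lambda>\<omega>. \<lambda>i\<in>{k}. X i \<omega>)"
    by (rule indep_var_restrict) auto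
  have past: "(\<lambda>i\<in>{..<k}. X i \<omega>) = (\<lambda>i\<in>{..<k}. \<xi> (t (Suc i)) \<omega> - \<xi> (t i) \<omega>)" for \<omega>
    by (auto simp: X_def u_def restrict_def fun_eq_iff)
  have fut: "X k \<omega> = \<xi> (t k + \<tau>) \<omega> - \<xi> (t k) \<omega>" for \<omega> by (simp add: X_def u_def)
  let ?A = "{x \<in> space (PiM {..<k} (\<lambda>_. borel)). P x}"
  let ?C = "{x \<in> space (PiM {k} (\<lambda>_. borel :: real measure)). x k \<in> B}"
  have A: "?A \<in> sets (PiM {..<k} (\<lambda>_. borel))" using P by simp
  have C: "?C \<in> sets (PiM {k} (\<lambda>_. borel))" using B by measurable
  have "prob ((\<lambda>\<omega>. (\<lambda>i\<in>{..<k}. X i \<omega>, \<lambda>i\<in>{k}. X i \<omega>)) -` (?A \<times> ?C) \<inter> space M)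
      = prob ((\<lambda>\<omega>. \<lambda>i\<in>{..<k}. X i \<omega>) -` ?A \<inter> space M) * prob ((\<lambda>\<omega>. \<lambda>i\<in>{k}. X i \<omega>) -` ?C \<inter> space M)"
    by (rule indep_varD[OF ind A C])
  moreover have "(\<lambda>\<omega>. (\<lambda>i\<in>{..<k}. X i \<omega>, \<lambda>i\<in>{k}. X i \<omega>)) -` (?A \<times> ?C) \<inter> space M
      = {\<omega> \<in> space M. P (\<lambda>i\<in>{..<k}. X i \<omega>) \<and> X k \<omega> \<in> B}"
    by (auto simp: space_PiM)
  moreover have "(\<lambda>\<omega>. \<lambda>i\<in>{..<k}. X i \<omega>) -` ?A \<inter> space M = {\<omega> \<in> space M. P (\<lambda>i\<in>{..<k}. X i \<omega>)}"
    by (auto simp: space_PiM)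
  moreover have "(\<lambda>\<omega>. \<lambda>i\<in>{k}. X i \<omega>) -` ?C \<inter> space M = {\<omega> \<in> space M. X k \<omega> \<in> B}"
    by (auto simp: space_PiM)
  ultimately show ?thesis by (simp add: past fut)
qed

text \<open>A first-entrance decomposition: \<open>F k\<close> is the event that a set is entered first at step
  \<open>k\<close>, and \<open>G k\<close> a later event of conditional probability at least one half.\<close>

lemma (in prob_space) prob_UN_le_twice:
  fixes F G :: "nat \<Rightarrow> 'a set"
  assumes sets: "\<And>k. F k \<in> sets M" "\<And>k. G k \<in> sets M" and disj: "disjoint_family F"
    and half: "\<And>k. prob (F k) \<le> 2 * prob (F k \<inter> G k)"
  shows "prob (\<Union>k. F k) \<le> 2 * prob (\<Union>k. F k \<inter> G k)"
proof -
  have F: "(\<lambda>k. prob (F k)) sums prob (\<Union>k. F k)"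
    using sets disj by (intro finite_measure_UNION) auto
  have "disjoint_family (\<lambda>k. F k \<inter> G k)"
    using disj unfolding disjoint_family_on_def by blast
  then have FG: "(\<lambda>k. prob (F k \<inter> G k)) sums prob (\<Union>k. F k \<inter> G k)"
    using sets by (intro finite_measure_UNION) auto
  show ?thesis by (rule sums_le[OF half F sums_mult[OF FG]])
qed

text \<open>Once a grid point of the path is in \<open>[a, a + \<delta>)\<close>, the increment over the next time span
  \<open>\<tau>\<close> is independent of the past and at most \<open>\<delta>\<close> with probability at least one half.
  In that case monotonicity keeps the path in \<open>[a, a + 2 \<delta>)\<close> over the whole span, which contains a
  multiple of \<open>\<tau>\<close>.  The bound does not depend on the mesh \<open>h\<close>.\<close>

lemma (in subordinator) grid_hit_le:
  assumes lap: "\<And>t q. 0 \<le> t \<Longrightarrow> 0 \<le> q \<Longrightarrow> expectation (\<lambda>\<omega>. exp (- q * \<xi> t \<omega>)) = exp (- t * \<phi> q)"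
    and "0 < h" "0 < \<tau>" "0 < \<delta>" and small: "\<tau> * \<phi> (1 / \<delta>) \<le> 1 / 4"
  shows "prob {\<omega> \<in> space M. \<exists>k::nat. \<xi> (real k * h) \<omega> \<in> {a..<a + \<delta>}}
    \<le> 2 * prob {\<omega> \<in> space M. \<exists>i::nat. \<xi> (real i * \<tau>) \<omega> \<in> {a..<a + 2 * \<delta>}}"
proof -
  define t where "t k = real k * h" for k :: nat
  have t: "mono t" "t 0 = 0" "\<And>k. 0 \<le> t k"
    using \<open>0 < h\<close> by (auto simp: t_def mono_def mult_right_mono)
  have [measurable]: "\<xi> (t k) \<in> borel_measurable M" "\<xi> (t k + \<tau>) \<in> borel_measurable M"
    "\<xi> (real k * \<tau>) \<in> borel_measurable M" for k
    using t(3)[of k] \<open>0 < \<tau>\<close> by (auto intro: measurable_process)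
  define I where "I = {a..<a + \<delta>}"
  have [measurable]: "I \<in> sets borel" by (simp add: I_def)
  \<comment> \<open>Subtracting \<open>\<xi> 0\<close>, which vanishes only almost surely, makes \<open>S\<close> a sum of increments.\<close>
  define S where "S i \<omega> = \<xi> (t i) \<omega> - \<xi> (t 0) \<omega>" for i \<omega>
  define F where "F k = {\<omega> \<in> space M. S k \<omega> \<in> I \<and> (\<forall>i<k. S i \<omega> \<notin> I)}" for k
  define G where "G k = {\<omega> \<in> space M. \<xi> (t k + \<tau>) \<omega> - \<xi> (t k) \<omega> \<in> {..\<delta>}}" for k
  have F: "F k \<in> sets M" and G: "G k \<in> sets M" for k
    unfolding F_def G_def S_def by measurable
  have half: "prob (F k) \<le> 2 * prob (F k \<inter> G k)" for k
  proof -
    define P :: "(nat \<Rightarrow> real) \<Rightarrow> bool"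
      where "P x \<longleftrightarrow> (\<Sum>l<k. x l) \<in> I \<and> (\<forall>i<k. (\<Sum>l<i. x l) \<notin> I)" for x
    have P [measurable]: "Measurable.pred (PiM {..<k} (\<lambda>_. borel)) P"
      unfolding P_def
      by (intro pred_intros_logic pred_intros_countable_bounded pred_sets2[of I borel]
          borel_measurable_sum measurable_component_singleton) auto
    have sum: "(\<Sum>l<i. (\<lambda>l\<in>{..<k}. \<xi> (t (Suc l)) \<omega> - \<xi> (t l) \<omega>) l) = S i \<omega>" if "i \<le> k" for i \<omega>
      using that sum_lessThan_telescope[of "\<lambda>l. \<xi> (t l) \<omega>" i] by (simp add: S_def)
    have FP: "P (\<lambda>l\<in>{..<k}. \<xi> (t (Suc l)) \<omega> - \<xi> (t l) \<omega>) \<longleftrightarrow> S k \<omega> \<in> I \<and> (\<forall>i<k. S i \<omega> \<notin> I)" for \<omega>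
      unfolding P_def using sum by auto
    have "prob (F k \<inter> G k) = prob (F k) * prob (G k)"
      using indep_past_increment[OF t(1,2) _ P, of \<tau> "{..\<delta>}"] \<open>0 < \<tau>\<close>
      unfolding FP F_def G_def by (simp add: Int_def conj_ac)
    moreover have "1 / 2 \<le> prob (G k)"
      using prob_increment_le[OF lap t(3) less_imp_le[OF \<open>0 < \<tau>\<close>] \<open>0 < \<delta>\<close> small]
      by (simp add: G_def)
    then have "prob (F k) * (1 / 2) \<le> prob (F k) * prob (G k)"
      by (rule mult_left_mono) simp
    ultimately show ?thesis by simp
  qed
  have "prob {\<omega> \<in> space M. \<exists>k::nat. \<xi> (real k * h) \<omega> \<in> {a..<a + \<delta>}} \<le> prob (\<Union>k. F k)"
  proof (rule finite_measure_mono_AE)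
    show "AE \<omega> in M. \<omega> \<in> {\<omega> \<in> space M. \<exists>k::nat. \<xi> (real k * h) \<omega> \<in> {a..<a + \<delta>}} \<longrightarrow> \<omega> \<in> (\<Union>k. F k)"
      using start_zero
    proof eventually_elim
      case (elim \<omega>)
      show ?case
      proof
        assume "\<omega> \<in> {\<omega> \<in> space M. \<exists>k::nat. \<xi> (real k * h) \<omega> \<in> {a..<a + \<delta>}}"
        then obtain k where "\<omega> \<in> space M" "S k \<omega> \<in> I"
          using elim t(2) by (auto simp: S_def I_def t_def)
        moreover define k0 where "k0 = (LEAST k. S k \<omega> \<in> I)"
        ultimately have "\<omega> \<in> F k0"
          unfolding F_def by (auto intro: LeastI dest: not_less_Least)
        then show "\<omega> \<in> (\<Union>k. F k)" by auto
      qed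
    qed
  qed (use F in auto)
  also have "\<dots> \<le> 2 * prob (\<Union>k. F k \<inter> G k)"
  proof (rule prob_UN_le_twice[OF F G _ half])
    show "disjoint_family F"
      unfolding disjoint_family_on_def
    proof (intro ballI impI)
      fix m n :: nat assume "m \<noteq> n"
      then show "F m \<inter> F n = {}" by (cases m n rule: linorder_cases) (auto simp: F_def)
    qed
  qed
  also have "prob (\<Union>k. F k \<inter> G k)
      \<le> prob {\<omega> \<in> space M. \<exists>i::nat. \<xi> (real i * \<tau>) \<omega> \<in> {a..<a + 2 * \<delta>}}"
  proof (rule finite_measure_mono_AE)
    show "AE \<omega> in M. \<omega> \<in> (\<Union>k. F k \<inter> G k) \<longrightarrow>
        \<omega> \<in> {\<omega> \<in> space M. \<exists>i::nat. \<xi> (real i * \<tau>) \<omega> \<in> {a..<a + 2 * \<delta>}}"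
      using start_zero increasing
    proof eventually_elim
      case (elim \<omega>)
      show ?case
      proof
        assume "\<omega> \<in> (\<Union>k. F k \<inter> G k)"
        then obtain k where k: "\<omega> \<in> space M" "\<xi> (t k) \<omega> \<in> I" "\<xi> (t k + \<tau>) \<omega> - \<xi> (t k) \<omega> \<le> \<delta>"
          using elim(1) t(2) by (auto simp: F_def G_def S_def)
        define i where "i = nat \<lceil>t k / \<tau>\<rceil>"
        have "real i = \<lceil>t k / \<tau>\<rceil>" using t(3)[of k] \<open>0 < \<tau>\<close> by (simp add: i_def)
        then have "t k / \<tau> \<le> real i" "real i < t k / \<tau> + 1" by linarith+
        then have i: "t k \<le> real i * \<tau>" "real i * \<tau> \<le> t k + \<tau>"
          using \<open>0 < \<tau>\<close> by (auto simp: field_simps)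
        have "\<xi> (t k) \<omega> \<le> \<xi> (real i * \<tau>) \<omega>" "\<xi> (real i * \<tau>) \<omega> \<le> \<xi> (t k + \<tau>) \<omega>"
          using i t(3)[of k] \<open>0 < \<tau>\<close> by (auto intro!: mono_onD[OF elim(2)])
        then show "\<omega> \<in> {\<omega> \<in> space M. \<exists>i::nat. \<xi> (real i * \<tau>) \<omega> \<in> {a..<a + 2 * \<delta>}}"
          using k by (auto simp: I_def intro!: exI[of _ i])
      qed
    qed
  qed measurable
  finally show ?thesis by simp
qed

text \<open>The dyadic grids of mesh \<open>1 / 2 ^ m\<close> increase with \<open>m\<close>, so the bound for a fixed mesh
  passes to the limit.\<close>

lemma (in subordinator) dyadic_visit_le:
  assumes lap: "\<And>t q. 0 \<le> t \<Longrightarrow> 0 \<le> q \<Longrightarrow> expectation (\<lambda>\<omega>. exp (- q * \<xi> t \<omega>)) = exp (- t * \<phi> q)"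
    and "0 < \<tau>" "0 < \<delta>" and small: "\<tau> * \<phi> (1 / \<delta>) \<le> 1 / 4"
  shows "prob (dyadic_visit M \<xi> a (a + \<delta>))
    \<le> 2 * prob {\<omega> \<in> space M. \<exists>i::nat. \<xi> (real i * \<tau>) \<omega> \<in> {a..<a + 2 * \<delta>}}"
proof -
  define A where "A m = {\<omega> \<in> space M. \<exists>i::nat. \<xi> (real i * (1 / 2 ^ m)) \<omega> \<in> {a..<a + \<delta>}}" for m :: nat
  have [measurable]: "\<xi> (real i * (1 / 2 ^ m)) \<in> borel_measurable M" for i m :: nat
    by (rule measurable_process) simp
  have "A m \<in> sets M" for m unfolding A_def by measurable
  moreover have "incseq A"
  proof (rule incseq_SucI, rule subsetI)
    fix m \<omega> assume "\<omega> \<in> A m"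
    then obtain i :: nat where "\<omega> \<in> space M" "\<xi> (real i * (1 / 2 ^ m)) \<omega> \<in> {a..<a + \<delta>}"
      by (auto simp: A_def)
    moreover have "real (2 * i) * (1 / 2 ^ Suc m) = real i * (1 / 2 ^ m)" by simp
    ultimately show "\<omega> \<in> A (Suc m)" unfolding A_def by (metis (mono_tags, lifting) mem_Collect_eq)
  qed
  ultimately have "(\<lambda>m. prob (A m)) \<longlonglongrightarrow> prob (\<Union>m. A m)"
    by (intro finite_Lim_measure_incseq) auto
  moreover have "(\<Union>m. A m) = dyadic_visit M \<xi> a (a + \<delta>)"
    by (auto simp: A_def dyadic_visit_def)
  ultimately have "(\<lambda>m. prob (A m)) \<longlonglongrightarrow> prob (dyadic_visit M \<xi> a (a + \<delta>))" by simp
  then show ?thesis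
  proof (rule LIMSEQ_le_const2)
    show "\<exists>N. \<forall>m\<ge>N. prob (A m)
        \<le> 2 * prob {\<omega> \<in> space M. \<exists>i::nat. \<xi> (real i * \<tau>) \<omega> \<in> {a..<a + 2 * \<delta>}}"
      unfolding A_def by (intro exI allI impI grid_hit_le[OF lap]) (use assms in auto)
  qed
qed

text \<open>Markov's inequality for \<open>exp (- \<xi> t)\<close>.\<close>

lemma (in subordinator) prob_le_exp:
  assumes lap: "\<And>t q. 0 \<le> t \<Longrightarrow> 0 \<le> q \<Longrightarrow> expectation (\<lambda>\<omega>. exp (- q * \<xi> t \<omega>)) = exp (- t * \<phi> q)"
    and "0 \<le> t"
  shows "prob {\<omega> \<in> space M. \<xi> t \<omega> \<le> x} \<le> exp x * exp (- t * \<phi> 1)"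
proof -
  have [measurable]: "\<xi> t \<in> borel_measurable M" using assms by (auto intro: measurable_process)
  have "prob {\<omega> \<in> space M. \<xi> t \<omega> \<le> x} = expectation (indicator {\<omega> \<in> space M. \<xi> t \<omega> \<le> x})"
    by simp
  also have "\<dots> \<le> expectation (\<lambda>\<omega>. exp x * exp (- 1 * \<xi> t \<omega>))"
  proof (rule integral_mono)
    show "integrable M (\<lambda>\<omega>. exp x * exp (- 1 * \<xi> t \<omega>))"
      using integrable_exp[of t 1] assms by simp
    show "indicator {\<omega> \<in> space M. \<xi> t \<omega> \<le> x} \<omega> \<le> exp x * exp (- 1 * \<xi> t \<omega>)" for \<omega>
      by (auto simp: indicator_def simp flip: exp_add)
  qed (auto simp: emeasure_eq_measure)
  also have "\<dots> = exp x * exp (- t * \<phi> 1)"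
    using lap[of t 1] assms by simp
  finally show ?thesis .
qed

text \<open>The minimum of the hitting probabilities over the cells is at most their average, which is of
  order \<open>\<phi> q / q\<close> with \<open>q = 2 N\<close>.  Only the left half of each cell serves as a target, so that the
  cells, in which the path is caught at a multiple of \<open>\<tau>\<close>, are disjoint.\<close>

lemma (in subordinator) exists_rarely_visited_interval:
  assumes lap: "\<And>t q. 0 \<le> t \<Longrightarrow> 0 \<le> q \<Longrightarrow> expectation (\<lambda>\<omega>. exp (- q * \<xi> t \<omega>)) = exp (- t * \<phi> q)"
    and pos: "0 < \<phi> 1" and mono: "\<And>q. 1 \<le> q \<Longrightarrow> \<phi> 1 \<le> \<phi> q"
    and sub: "((\<lambda>q. \<phi> q / q) \<longlongrightarrow> 0) at_top" and "0 < \<epsilon>"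
  shows "\<exists>a b. y \<le> a \<and> a < b \<and> b \<le> y + 1 \<and> prob (dyadic_visit M \<xi> a b) \<le> \<epsilon>"
proof -
  \<comment> \<open>The average over the cells turns out to be at most \<open>32 * exp (y + 1) / \<phi> 1\<close> times
    \<open>\<phi> q / q\<close>.\<close>
  define \<eta> where "\<eta> = \<epsilon> * \<phi> 1 / (32 * exp (y + 1))"
  have "0 < \<eta>" using assms by (simp add: \<eta>_def)
  with order_tendstoD(2)[OF sub] have "\<forall>\<^sub>F q in at_top. \<phi> q / q < \<eta>" by blast
  moreover have "filterlim (\<lambda>N. 2 * real N) at_top sequentially"
    by (intro filterlim_tendsto_pos_mult_at_top[OF tendsto_const] filterlim_real_sequentially) simp
  ultimately have "\<forall>\<^sub>F N in sequentially. \<phi> (2 * real N) / (2 * real N) < \<eta>"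
    by (rule eventually_compose_filterlim)
  then obtain N :: nat where N: "1 \<le> N" "\<phi> (2 * real N) / (2 * real N) < \<eta>"
    by (metis (mono_tags, lifting) eventually_sequentially le_cases)
  define q where "q = 2 * real N"
  define \<delta> where "\<delta> = 1 / q"
  define \<tau> where "\<tau> = 1 / (4 * \<phi> q)"
  define r where "r = exp (- \<tau> * \<phi> 1)"
  have q: "2 \<le> q" "\<phi> q / q < \<eta>" using N by (auto simp: q_def)
  have \<phi>q: "\<phi> 1 \<le> \<phi> q" "0 < \<phi> q" using mono[of q] q pos by auto
  have \<delta>: "0 < \<delta>" and \<tau>: "0 < \<tau>" using q \<phi>q by (auto simp: \<delta>_def \<tau>_def)
  have small: "\<tau> * \<phi> (1 / \<delta>) \<le> 1 / 4" using \<phi>q by (simp add: \<tau>_def \<delta>_def)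
  have x: "0 < \<tau> * \<phi> 1" "\<tau> * \<phi> 1 \<le> 1 / 4" using \<phi>q \<tau> pos by (auto simp: \<tau>_def field_simps)
  have r: "0 < r" "r \<le> 1 - \<tau> * \<phi> 1 / 2"
  proof -
    let ?x = "\<tau> * \<phi> 1"
    have "1 + ?x \<le> exp ?x" by (rule exp_ge_add_one_self)
    then have "exp (- ?x) \<le> 1 / (1 + ?x)" using x by (simp add: exp_minus field_simps)
    also have "\<dots> \<le> 1 - ?x / 2"
    proof -
      have "?x * ?x \<le> ?x" using x mult_left_mono[of ?x 1 ?x] by simp
      then show ?thesis using x by (simp add: field_simps)
    qed
    finally show "r \<le> 1 - ?x / 2" by (simp add: r_def)
  qed (simp add: r_def)
  then have r1: "r < 1" using x by simp
  define c where "c j = y + real j / real N" for j :: nat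
  have cell: "c j + 2 * \<delta> = c (Suc j)" for j
    using N by (simp add: c_def \<delta>_def q_def field_simps)
  define w where "w i j = prob {\<omega> \<in> space M. \<xi> (real i * \<tau>) \<omega> \<in> {c j..<c j + 2 * \<delta>}}" for i j
  have [measurable]: "\<xi> (real i * \<tau>) \<in> borel_measurable M" for i :: nat
    using \<tau> by (auto intro: measurable_process)
  have w: "(\<Sum>j<N. w i j) \<le> exp (y + 1) * r ^ i" for i
  proof -
    let ?D = "\<lambda>j. {\<omega> \<in> space M. \<xi> (real i * \<tau>) \<omega> \<in> {c j..<c j + 2 * \<delta>}}"
    have cmono: "c i \<le> c j" if "i \<le> j" for i j
      using that by (auto simp: c_def divide_right_mono)
    have disj: "?D i \<inter> ?D j = {}" if "i < j" for i j
      using cmono[of "Suc i" j] that unfolding cell by auto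
    have "disjoint_family_on ?D {..<N}"
      unfolding disjoint_family_on_def
    proof (intro ballI impI)
      fix m n :: nat assume "m \<noteq> n"
      then show "?D m \<inter> ?D n = {}"
        using disj[of m n] disj[of n m] by (cases m n rule: linorder_cases) auto
    qed
    then have "(\<Sum>j<N. w i j) = prob (\<Union>j<N. ?D j)"
      unfolding w_def by (intro finite_measure_finite_Union[symmetric]) auto
    also have "\<dots> \<le> prob {\<omega> \<in> space M. \<xi> (real i * \<tau>) \<omega> \<le> y + 1}"
    proof (rule finite_measure_mono)
      have "c (Suc j) \<le> y + 1" if "j < N" for j
        using that by (simp add: c_def field_simps)
      then show "(\<Union>j<N. ?D j) \<subseteq> {\<omega> \<in> space M. \<xi> (real i * \<tau>) \<omega> \<le> y + 1}"
        unfolding cell by force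
    qed measurable
    also have "\<dots> \<le> exp (y + 1) * exp (- (real i * \<tau>) * \<phi> 1)"
      using \<tau> by (intro prob_le_exp[OF lap]) auto
    also have "exp (- (real i * \<tau>) * \<phi> 1) = r ^ i"
      by (simp add: r_def flip: exp_of_nat_mult)
    finally show ?thesis .
  qed
  have geo: "(\<lambda>i. exp (y + 1) * r ^ i) sums (exp (y + 1) * (1 / (1 - r)))"
    using r r1 by (intro sums_mult geometric_sums) simp
  have summ: "summable (\<lambda>i. w i j)" if "j < N" for j
  proof (rule summable_comparison_test'[OF sums_summable[OF geo], of 0])
    fix i
    have "w i j \<le> (\<Sum>j<N. w i j)" using that by (intro member_le_sum) (auto simp: w_def)
    then show "norm (w i j) \<le> exp (y + 1) * r ^ i" using w[of i] by (simp add: w_def)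
  qed
  have "(\<Sum>j<N. prob (dyadic_visit M \<xi> (c j) (c j + \<delta>))) \<le> (\<Sum>j<N. 2 * (\<Sum>i. w i j))"
  proof (rule sum_mono)
    fix j assume j: "j \<in> {..<N}"
    have "prob (dyadic_visit M \<xi> (c j) (c j + \<delta>))
        \<le> 2 * prob {\<omega> \<in> space M. \<exists>i::nat. \<xi> (real i * \<tau>) \<omega> \<in> {c j..<c j + 2 * \<delta>}}"
      by (rule dyadic_visit_le[OF lap \<tau> \<delta> small])
    also have "{\<omega> \<in> space M. \<exists>i::nat. \<xi> (real i * \<tau>) \<omega> \<in> {c j..<c j + 2 * \<delta>}}
        = (\<Union>i. {\<omega> \<in> space M. \<xi> (real i * \<tau>) \<omega> \<in> {c j..<c j + 2 * \<delta>}})" by auto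
    also have "prob \<dots> \<le> (\<Sum>i. w i j)"
      unfolding w_def
      by (rule finite_measure_subadditive_countably) (use summ j in \<open>auto simp: w_def\<close>)
    finally show "prob (dyadic_visit M \<xi> (c j) (c j + \<delta>)) \<le> 2 * (\<Sum>i. w i j)" by simp
  qed
  also have "\<dots> = 2 * (\<Sum>i. \<Sum>j<N. w i j)"
    using summ by (subst suminf_sum) (auto simp: sum_distrib_left)
  also have "\<dots> \<le> 2 * (exp (y + 1) * (1 / (1 - r)))"
  proof -
    have "(\<Sum>i. \<Sum>j<N. w i j) \<le> (\<Sum>i. exp (y + 1) * r ^ i)"
      by (intro suminf_le w sums_summable[OF geo] summable_sum) (use summ in auto)
    then show ?thesis using sums_unique[OF geo] by simp
  qed
  also have "\<dots> \<le> 2 * (exp (y + 1) * (1 / (\<tau> * \<phi> 1 / 2)))"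
    using r x r1 by (intro mult_left_mono divide_left_mono) auto
  also have "\<dots> = \<phi> q * (16 * exp (y + 1) / \<phi> 1)"
    using \<phi>q pos by (simp add: \<tau>_def field_simps)
  also have "\<dots> < (\<eta> * q) * (16 * exp (y + 1) / \<phi> 1)"
    using q pos by (intro mult_strict_right_mono) (auto simp: field_simps)
  also have "\<dots> = real N * \<epsilon>"
    using pos by (simp add: \<eta>_def q_def field_simps)
  finally have less: "(\<Sum>j<N. prob (dyadic_visit M \<xi> (c j) (c j + \<delta>))) < real N * \<epsilon>" .
  have "\<exists>j<N. prob (dyadic_visit M \<xi> (c j) (c j + \<delta>)) \<le> \<epsilon>"
  proof (rule ccontr)
    assume "\<not> ?thesis"
    then have "(\<Sum>j<N. \<epsilon>) \<le> (\<Sum>j<N. prob (dyadic_visit M \<xi> (c j) (c j + \<delta>)))"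
      by (intro sum_mono) force
    with less show False by simp
  qed
  then obtain j where j: "j < N" "prob (dyadic_visit M \<xi> (c j) (c j + \<delta>)) \<le> \<epsilon>" by blast
  have "c j + \<delta> \<le> c (Suc j)" using cell[of j] \<delta> by linarith
  also have "c (Suc j) \<le> y + 1" using j by (simp add: c_def field_simps)
  finally show ?thesis using j \<delta> by (intro exI[of _ "c j"] exI[of _ "c j + \<delta>"]) (auto simp: c_def)
qed

section \<open>Bumps on rarely visited intervals\<close>

lemma (in subordinator) AE_unbounded:
  assumes lap: "\<And>t q. 0 \<le> t \<Longrightarrow> 0 \<le> q \<Longrightarrow> expectation (\<lambda>\<omega>. exp (- q * \<xi> t \<omega>)) = exp (- t * \<phi> q)"
    and pos: "0 < \<phi> 1"
  shows "AE \<omega> in M. \<forall>x. \<exists>t\<ge>0. x < \<xi> t \<omega>"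
proof -
  have [measurable]: "\<xi> (real i) \<in> borel_measurable M" for i by (rule measurable_process) simp
  have "AE \<omega> in M. \<exists>i::nat. real n < \<xi> (real i) \<omega>" for n :: nat
  proof -
    let ?A = "\<lambda>i. {\<omega> \<in> space M. \<xi> (real i) \<omega> \<le> real n}"
    have "summable (\<lambda>i. prob (?A i))"
    proof (rule summable_comparison_test'[of "\<lambda>i. exp (real n) * exp (- \<phi> 1) ^ i" 0])
      show "summable (\<lambda>i. exp (real n) * exp (- \<phi> 1) ^ i)"
        using pos by (intro summable_mult summable_geometric) simp
      show "norm (prob (?A i)) \<le> exp (real n) * exp (- \<phi> 1) ^ i" for i
        using prob_le_exp[OF lap, of "real i" "real n"] by (simp flip: exp_of_nat_mult)
    qed
    then have "AE \<omega> in M. eventually (\<lambda>i. \<omega> \<in> space M - ?A i) sequentially"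
      by (intro borel_cantelli_AE1) (auto simp: emeasure_eq_measure)
    then show ?thesis
      by eventually_elim (auto simp: eventually_sequentially not_le)
  qed
  then have "AE \<omega> in M. \<forall>n::nat. \<exists>i::nat. real n < \<xi> (real i) \<omega>" by (simp add: AE_all_countable)
  then show ?thesis
  proof eventually_elim
    case (elim \<omega>)
    show ?case
    proof
      fix x :: real
      obtain n :: nat where "x < real n" using reals_Archimedean2 by blast
      moreover obtain i :: nat where "real n < \<xi> (real i) \<omega>" using elim by blast
      ultimately show "\<exists>t\<ge>0. x < \<xi> t \<omega>" by (intro exI[of _ "real i"]) auto
    qed
  qed
qed

text \<open>By right-continuity and monotonicity the path stays in \<open>[a, b)\<close> for a short while after
  \<open>t\<close>, hence up to some dyadic time.\<close>

lemma mem_dyadic_visitI: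
  assumes \<omega>: "\<omega> \<in> space M" and mono: "mono_on {0..} (\<lambda>s. \<xi> s \<omega>)"
    and cont: "continuous (at_right t) (\<lambda>s. \<xi> s \<omega>)" and t: "0 \<le> t" "\<xi> t \<omega> \<in> {a..<b}"
  shows "\<omega> \<in> dyadic_visit M \<xi> a b"
proof -
  have "\<forall>\<^sub>F s in at_right t. \<xi> s \<omega> < b"
    using cont t by (intro order_tendstoD(2)[of _ "\<xi> t \<omega>"]) (auto simp: continuous_within)
  then obtain u where u: "t < u" "\<And>s. t < s \<Longrightarrow> s < u \<Longrightarrow> \<xi> s \<omega> < b"
    by (auto simp: eventually_at_right_field)
  obtain m :: nat where m: "1 / (u - t) < 2 ^ m"
    using real_arch_pow[of 2 "1 / (u - t)"] by auto
  define i where "i = nat (\<lfloor>t * 2 ^ m\<rfloor> + 1)"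
  have "real i = \<lfloor>t * 2 ^ m\<rfloor> + 1" using t by (simp add: i_def)
  then have i: "t * 2 ^ m < real i" "real i \<le> t * 2 ^ m + 1" by linarith+
  have "t * 2 ^ m + 1 < u * 2 ^ m" using m u(1) by (simp add: field_simps)
  then have s: "t < real i / 2 ^ m" "real i / 2 ^ m < u" using i by (auto simp: field_simps)
  have "\<xi> t \<omega> \<le> \<xi> (real i / 2 ^ m) \<omega>" using s t by (intro mono_onD[OF mono]) auto
  with u(2)[OF s] t \<omega> show ?thesis unfolding dyadic_visit_def by force
qed

text \<open>The sum of tent functions, the \<open>n\<close>-th supported in \<open>[a n, b n]\<close>.  It is locally finite, hence
  continuous.\<close>

lemma exists_bump_function:
  fixes a b :: "nat \<Rightarrow> real"
  assumes ab: "\<And>n. real n \<le> a n \<and> a n < b n \<and> b n \<le> real n + 1"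
  obtains f :: "real \<Rightarrow> real" where
    "continuous_on UNIV f" "\<And>y. 0 \<le> f y" "(\<integral>\<^sup>+y\<in>{0..}. ennreal (f y) \<partial>lborel) = \<infinity>"
    "\<And>y. f y \<noteq> 0 \<Longrightarrow> \<exists>n. y \<in> {a n..<b n}"
proof -
  define w where "w n = (b n - a n) / 2" for n
  define c where "c n = (a n + b n) / 2" for n
  \<comment> \<open>With this height \<open>g n\<close> is at least \<open>1 / w n\<close> on an interval of length \<open>w n\<close>, so its integral
    is at least \<open>1\<close>.\<close>
  define g where "g n y = max 0 (2 / (w n)\<^sup>2 * (w n - \<bar>y - c n\<bar>))" for n y
  define f where "f y = (\<Sum>n. g n y)" for y
  have w: "0 < w n" for n using ab[of n] by (simp add: w_def)
  have g0: "0 \<le> g n y" for n y by (simp add: g_def)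
  have gsupp: "y \<in> {a n<..<b n}" if "g n y \<noteq> 0" for n y
  proof -
    have "0 < 2 / (w n)\<^sup>2 * (w n - \<bar>y - c n\<bar>)" using that unfolding g_def by linarith
    then have "0 < w n - \<bar>y - c n\<bar>" by (rule zero_less_mult_pos) (use w[of n] in auto)
    moreover have "c n - w n = a n" "c n + w n = b n" by (auto simp: c_def w_def field_simps)
    ultimately show ?thesis by (auto simp: abs_less_iff)
  qed
  have f_eq: "f y = (\<Sum>n<K. g n y)" if "y < real K" for y K
    unfolding f_def
  proof (rule suminf_finite)
    fix n assume "n \<notin> {..<K}"
    then have "y < a n" using that ab[of n] by simp
    then show "g n y = 0" using gsupp[of n y] by fastforce
  qed simp
  have f_sum_le: "(\<Sum>n<K. g n y) \<le> f y" for y K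
  proof -
    obtain L :: nat where L: "y < real L" using reals_Archimedean2 by blast
    have "(\<Sum>n<K. g n y) \<le> (\<Sum>n<max K L. g n y)" using g0 by (intro sum_mono2) auto
    also have "\<dots> = f y" using L by (intro f_eq[symmetric]) auto
    finally show ?thesis .
  qed
  have gcont: "continuous_on S (g n)" for S n
    unfolding g_def by (intro continuous_intros)
  have "continuous_on (\<Union>K::nat. {..<real K}) f"
  proof (rule continuous_on_open_UN)
    fix K :: nat
    have "continuous_on {..<real K} (\<lambda>y. \<Sum>n<K. g n y)" by (intro continuous_intros gcont)
    then show "continuous_on {..<real K} f" by (rule continuous_on_eq) (simp add: f_eq)
  qed simp
  moreover have "(\<Union>K::nat. {..<real K}) = UNIV" using reals_Archimedean2 by auto
  ultimately have fcont: "continuous_on UNIV f" by simp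
  have f0: "0 \<le> f y" for y using f_sum_le[where K = 0 and y = y] by simp
  have "of_nat K \<le> (\<integral>\<^sup>+y\<in>{0..}. ennreal (f y) \<partial>lborel)" for K
  proof -
    let ?I = "\<lambda>n. {c n - w n / 2..c n + w n / 2}"
    have [simp]: "(\<integral>\<^sup>+y. ennreal (1 / w n) * indicator (?I n) y \<partial>lborel) = 1" for n
      using w[of n] by (subst nn_integral_cmult_indicator) (auto simp flip: ennreal_mult)
    have "of_nat K = (\<Sum>n<K. \<integral>\<^sup>+y. ennreal (1 / w n) * indicator (?I n) y \<partial>lborel)" by simp
    also have "\<dots> = (\<integral>\<^sup>+y. (\<Sum>n<K. ennreal (1 / w n) * indicator (?I n) y) \<partial>lborel)"
      by (subst nn_integral_sum) auto
    also have "\<dots> \<le> (\<integral>\<^sup>+y\<in>{0..}. ennreal (f y) \<partial>lborel)"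
    proof (rule nn_integral_mono)
      fix y :: real
      have le: "ennreal (1 / w n) * indicator (?I n) y \<le> ennreal (g n y) * indicator {0..} y" for n
      proof (cases "y \<in> ?I n")
        case True
        then have "w n / 2 \<le> w n - \<bar>y - c n\<bar>" by (simp add: abs_if)
        then have "2 / (w n)\<^sup>2 * (w n / 2) \<le> 2 / (w n)\<^sup>2 * (w n - \<bar>y - c n\<bar>)"
          by (rule mult_left_mono) simp
        then have "1 / w n \<le> g n y" using w[of n] by (simp add: g_def power2_eq_square)
        moreover from this w[of n] have "g n y \<noteq> 0" by (metis divide_pos_pos not_le zero_less_one)
        then have "0 \<le> y" using gsupp[of n y] ab[of n] by auto
        ultimately show ?thesis using True by (simp add: ennreal_leI)
      qed simp
      have "(\<Sum>n<K. ennreal (1 / w n) * indicator (?I n) y)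
          \<le> (\<Sum>n<K. ennreal (g n y) * indicator {0..} y)" by (intro sum_mono le)
      also have "\<dots> = ennreal (\<Sum>n<K. g n y) * indicator {0..} y"
        using g0 by (simp add: sum_distrib_right[symmetric] sum_ennreal)
      also have "\<dots> \<le> ennreal (f y) * indicator {0..} y"
        by (intro mult_right_mono ennreal_leI f_sum_le) simp
      finally show "(\<Sum>n<K. ennreal (1 / w n) * indicator (?I n) y) \<le> ennreal (f y) * indicator {0..} y" .
    qed
    finally show ?thesis .
  qed
  then have inf: "(\<integral>\<^sup>+y\<in>{0..}. ennreal (f y) \<partial>lborel) = \<infinity>"
    by (metis ennreal_Ex_less_of_nat infinity_ennreal_def leD top.not_eq_extremum)
  have "\<exists>n. y \<in> {a n..<b n}" if "f y \<noteq> 0" for y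
  proof (rule ccontr)
    assume "\<nexists>n. y \<in> {a n..<b n}"
    then have "g n y = 0" for n using gsupp[of n y] by fastforce
    then have "f y = 0" by (simp add: f_def)
    with that show False by simp
  qed
  with fcont f0 inf show thesis by (rule that)
qed

text \<open>Up to time \<open>T\<close> a monotone path stays in the compact interval \<open>[x 0, x T]\<close>, on which \<open>f\<close> is
  bounded.\<close>

lemma nn_integral_eventually_zero_path:
  fixes x :: "real \<Rightarrow> real"
  assumes mono: "mono_on {0..} x" and f: "continuous_on UNIV f" "\<And>y. 0 \<le> f y"
    and zero: "\<And>s. T \<le> s \<Longrightarrow> f (x s) = 0" and "0 \<le> T"
  shows "(\<integral>\<^sup>+s\<in>{0..}. ennreal (f (x s)) \<partial>lborel) < \<infinity>"
proof -
  have "compact (f ` {x 0..x T})"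
    by (intro compact_continuous_image continuous_on_subset[OF f(1)]) auto
  then obtain B where B: "\<And>y. y \<in> {x 0..x T} \<Longrightarrow> norm (f y) \<le> B"
    using bounded_iff compact_imp_bounded by (metis imageI)
  have "(\<integral>\<^sup>+s\<in>{0..}. ennreal (f (x s)) \<partial>lborel) \<le> (\<integral>\<^sup>+s. ennreal B * indicator {0..T} s \<partial>lborel)"
  proof (rule nn_integral_mono)
    fix s :: real
    show "ennreal (f (x s)) * indicator {0..} s \<le> ennreal B * indicator {0..T} s"
    proof (cases "0 \<le> s \<and> s \<le> T")
      case True
      then have "x s \<in> {x 0..x T}" using \<open>0 \<le> T\<close> by (auto intro!: mono_onD[OF mono])
      with B[of "x s"] True show ?thesis by (auto intro!: ennreal_leI)
    next
      case False
      then show ?thesis using zero[of s] by (auto simp: indicator_def)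
    qed
  qed
  also have "\<dots> = ennreal B * ennreal T"
    using \<open>0 \<le> T\<close> by (subst nn_integral_cmult_indicator) auto
  also have "\<dots> < \<infinity>" by (simp add: ennreal_mult_less_top)
  finally show ?thesis .
qed

theorem mainTheorem3:
  fixes M :: "'a measure" and \<xi> :: "real \<Rightarrow> 'a \<Rightarrow> real" and \<nu> :: "real measure"
  assumes "subordinator M \<xi>"
    and no_drift: "has_drift_and_levy_measure M \<xi> 0 \<nu>"
    and infinite_activity: "emeasure \<nu> {0<..} = \<infinity>"
    and jumps_le_1: "AE \<omega> in M. \<forall>t>0. jump \<xi> t \<omega> \<le> 1"
  shows "\<exists>f :: real \<Rightarrow> real.
           continuous_on UNIV f \<and> (\<forall>y. 0 \<le> f y) \<and>
           (\<integral>\<^sup>+y\<in>{0..}. ennreal (f y) \<partial>lborel) = \<infinity> \<and>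
           (AE \<omega> in M. (\<integral>\<^sup>+s\<in>{0..}. ennreal (f (\<xi> s \<omega>)) \<partial>lborel) < \<infinity>)"
proof -
  interpret subordinator M \<xi> by fact
  let ?\<phi> = "laplace_exponent 0 \<nu>"
  have lap: "expectation (\<lambda>\<omega>. exp (- q * \<xi> t \<omega>)) = exp (- t * ?\<phi> q)" if "0 \<le> t" "0 \<le> q" for t q
    using no_drift that unfolding has_drift_and_levy_measure_def by blast
  have pos: "0 < ?\<phi> 1"
    by (rule laplace_exponent_one_pos[OF no_drift]) (simp add: infinite_activity)
  have "\<exists>a b. real n \<le> a \<and> a < b \<and> b \<le> real n + 1 \<and> prob (dyadic_visit M \<xi> a b) \<le> (1 / 2) ^ n" for n
    using laplace_exponent_mono[OF no_drift, of 1] laplace_exponent_sublinear[OF no_drift]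
    by (intro exists_rarely_visited_interval[OF lap pos]) auto
  then obtain a b where ab: "\<And>n. real n \<le> a n \<and> a n < b n \<and> b n \<le> real n + 1"
    and rare: "\<And>n. prob (dyadic_visit M \<xi> (a n) (b n)) \<le> (1 / 2) ^ n"
    by metis
  obtain f where f: "continuous_on UNIV f" "\<And>y. 0 \<le> f y"
      "(\<integral>\<^sup>+y\<in>{0..}. ennreal (f y) \<partial>lborel) = \<infinity>" "\<And>y. f y \<noteq> 0 \<Longrightarrow> \<exists>n. y \<in> {a n..<b n}"
    using exists_bump_function[OF ab] by blast
  have unbounded: "AE \<omega> in M. \<forall>x. \<exists>t\<ge>0. x < \<xi> t \<omega>"
    by (rule AE_unbounded[where \<phi> = ?\<phi>, OF _ pos]) (rule lap)
  have "summable (\<lambda>n. prob (dyadic_visit M \<xi> (a n) (b n)))"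
    by (rule summable_comparison_test'[of "\<lambda>n. (1 / 2) ^ n" 0]) (use rare in auto)
  then have "AE \<omega> in M. eventually (\<lambda>n. \<omega> \<in> space M - dyadic_visit M \<xi> (a n) (b n)) sequentially"
    by (intro borel_cantelli_AE1) (auto simp: emeasure_eq_measure dyadic_visit_sets)
  then have "AE \<omega> in M. (\<integral>\<^sup>+s\<in>{0..}. ennreal (f (\<xi> s \<omega>)) \<partial>lborel) < \<infinity>"
    using unbounded increasing cadlag
  proof eventually_elim
    case (elim \<omega>)
    then obtain K where K: "\<And>n. K \<le> n \<Longrightarrow> \<omega> \<in> space M - dyadic_visit M \<xi> (a n) (b n)"
      by (auto simp: eventually_sequentially)
    obtain T where T: "0 \<le> T" "real K < \<xi> T \<omega>" using elim by blast
    have "f (\<xi> s \<omega>) = 0" if "T \<le> s" for s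
    proof (rule ccontr)
      assume "f (\<xi> s \<omega>) \<noteq> 0"
      then obtain n where n: "\<xi> s \<omega> \<in> {a n..<b n}" using f(4) by blast
      have "\<xi> T \<omega> \<le> \<xi> s \<omega>" using T that by (intro mono_onD[OF elim(3)]) auto
      then have "real K < real n + 1" using T n ab[of n] by auto
      then have "K \<le> n" by linarith
      with K[of n] have \<omega>: "\<omega> \<in> space M" "\<omega> \<notin> dyadic_visit M \<xi> (a n) (b n)" by auto
      have "\<omega> \<in> dyadic_visit M \<xi> (a n) (b n)"
        by (rule mem_dyadic_visitI[of _ _ _ s]) (use \<omega> elim T that n in auto)
      with \<omega> show False by simp
    qed
    then show ?case
      using elim(3) f T by (intro nn_integral_eventually_zero_path[of _ f T]) auto
  qed
  with f show ?thesis by blast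
qed

end
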